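(* Consider a country with a finite set of voters $H$, several political parties (forming a finite set $T$), and several elections (forming a finite set $L$), with possibly different notions of what constitutes a "win" in different elections. Each voter $h\in H$ has a fixed probability $p_h\in[0,1]$ of voting on any poll date and always votes for the same party $t(h)\in T$. Suppose that: (a) each election can be won by at most one party; and (b) for any turnout in any election, an extra vote for some party cannot decrease its win probability, nor can it increase the win probability of a rival party. A sweep is an outcome in which one party wins all the elections. Let $\Pi$ and $\Pi'$ be two staggered polling schedules such that $\Pi$ is coarser than $\Pi'$, i.e. for every voter $h$, any two elections that are simultaneous for $h$ in $\Pi'$ are also simultaneous for $h$ in $\Pi$. Then a sweep is more likely under $\Pi$, in the weak sense: the probability of a sweep under schedule $\Pi$ is greater than or equal to the probability of a sweep under schedule $\Pi'$.
   Context: In a staggered polling schedule each election might be spread out over several days, with different poll dates for different regions. Such a schedule is described by a family $\Pi=(\pi_h)_{h\in H}$ where each $\pi_h$ is a partition of $L$; two elections are simultaneous for voter $h$ (have the same poll date for $h$) if they lie in the same part of $\pi_h$. Turnout: given $\Pi$, for each voter $h$ and each part $M\in\pi_h$ (a poll date for $h$), $h$ turns out on that date with probability $p_h$, independently across voters and across the different poll dates of each voter. If $h$ turns out on date $M$, then $h$ casts a vote for party $t(h)$ in every election $l\in M$; otherwise $h$ votes in no election $l\in M$. Win probabilities: for a given election and a given set of voters who have voted in it, each party has a probability of winning that election (one speaks of win probabilities since, for example, tied vote counts might lead to coin tosses). Writing $f_{l,s}(S)\in[0,1]$ for the probability that party $s\in T$ wins election $l\in L$ when $S\subseteq H$ is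 the set of voters who voted in it, condition (b) says that for all $l\in L$, $S\subseteq H$ and $h\in H$: $f_{l,t(h)}(S\cup\{h\})\ge f_{l,t(h)}(S)$, and $f_{l,s}(S\cup\{h\})\le f_{l,s}(S)$ for every $s\ne t(h)$. By (a), an election has at most one winning party, and it may have none. *)

theory Defs
  imports "HOL-Probability.Probability" "HOL-Library.Disjoint_Sets"
begin

text \<open>
  Voters, elections and parties form finite sets \<open>H\<close>, \<open>L\<close>, \<open>T\<close>. A schedule \<open>\<pi>\<close> assigns to each
  voter \<open>h\<close> a partition \<open>\<pi> h\<close> of \<open>L\<close>, whose parts are the poll dates for \<open>h\<close>.
\<close>

definition staggered_schedule :: "'h set \<Rightarrow> 'l set \<Rightarrow> ('h \<Rightarrow> 'l set set) \<Rightarrow> bool" where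
  "staggered_schedule H L \<pi> \<longleftrightarrow> (\<forall>h\<in>H. partition_on L (\<pi> h))"

definition simultaneous :: "('h \<Rightarrow> 'l set set) \<Rightarrow> 'h \<Rightarrow> 'l \<Rightarrow> 'l \<Rightarrow> bool" where
  "simultaneous \<pi> h l l' \<longleftrightarrow> (\<exists>M\<in>\<pi> h. l \<in> M \<and> l' \<in> M)"

definition coarser :: "'h set \<Rightarrow> 'l set \<Rightarrow> ('h \<Rightarrow> 'l set set) \<Rightarrow> ('h \<Rightarrow> 'l set set) \<Rightarrow> bool" where
  "coarser H L \<pi> \<pi>' \<longleftrightarrow>
    (\<forall>h\<in>H. \<forall>l\<in>L. \<forall>l'\<in>L. simultaneous \<pi>' h l l' \<longrightarrow> simultaneous \<pi> h l l')"

text \<open>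
  A turnout records, for each pair of a voter \<open>h\<close> and a date \<open>M \<in> \<pi> h\<close>, whether \<open>h\<close> turns out on
  that date; these events are independent, with probability \<open>p h\<close>.
\<close>

definition turnout_pmf ::
  "'h set \<Rightarrow> ('h \<Rightarrow> real) \<Rightarrow> ('h \<Rightarrow> 'l set set) \<Rightarrow> ('h \<times> 'l set \<Rightarrow> bool) pmf" where
  "turnout_pmf H p \<pi> = Pi_pmf (SIGMA h:H. \<pi> h) False (\<lambda>(h, M). bernoulli_pmf (p h))"

definition voted ::
  "'h set \<Rightarrow> ('h \<Rightarrow> 'l set set) \<Rightarrow> ('h \<times> 'l set \<Rightarrow> bool) \<Rightarrow> 'l \<Rightarrow> 'h set" where
  "voted H \<pi> x l = {h\<in>H. \<exists>M\<in>\<pi> h. l \<in> M \<and> x (h, M)}"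

text \<open>
  \<open>W l S\<close> is the distribution of the set of winning parties of election \<open>l\<close> when \<open>S\<close> is the set of
  voters who have voted in it. It may depend on \<open>l\<close> arbitrarily (different notions of a win) and
  need not be degenerate (coin tosses).
\<close>

definition win_prob :: "('l \<Rightarrow> 'h set \<Rightarrow> 't set pmf) \<Rightarrow> 'l \<Rightarrow> 't \<Rightarrow> 'h set \<Rightarrow> real" where
  "win_prob W l s S = measure_pmf.prob (W l S) {X. s \<in> X}"

text \<open>
  The joint distribution of the sets of winners of all elections. Given the turnout, the residual
  randomness (such as coin tosses) is independent across elections.
\<close>

definition outcome_pmf ::
  "'h set \<Rightarrow> 'l set \<Rightarrow> ('h \<Rightarrow> real) \<Rightarrow> ('l \<Rightarrow> 'h set \<Rightarrow> 't set pmf) \<Rightarrow> ('h \<Rightarrow> 'l set set) \<Rightarrow>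
    ('l \<Rightarrow> 't set) pmf" where
  "outcome_pmf H L p W \<pi> =
    bind_pmf (turnout_pmf H p \<pi>) (\<lambda>x. Pi_pmf L {} (\<lambda>l. W l (voted H \<pi> x l)))"

definition sweep :: "'l set \<Rightarrow> 't set \<Rightarrow> ('l \<Rightarrow> 't set) set" where
  "sweep L T = {w. \<exists>s\<in>T. \<forall>l\<in>L. s \<in> w l}"

end

theory Submission
  imports Defs
begin

text \<open>
  If there is at least one election, at most one party can win all of them, so the probability of
  a sweep is the sum over the parties \<open>s\<close> of the probability that \<open>s\<close> wins everywhere. Given the
  turnout the elections are decided independently, so the latter probability is the expectation of
  \<open>\<Prod>l\<in>L. f l V\<^sub>l\<close>, where \<open>V\<^sub>l\<close> is the set of voters of election \<open>l\<close> and \<open>f l S\<close> is the probability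
  that \<open>s\<close> wins \<open>l\<close> with electorate \<open>S\<close>. It is enough to show that, for each \<open>s\<close> separately, a
  coarser schedule does not decrease this expectation.

  The only property of \<open>f\<close> that matters is that each voter acts in the same direction everywhere: a
  supporter of \<open>s\<close> raises all the factors by voting, anybody else lowers all of them
  (\<open>votes_aligned\<close>). This property survives conditioning on the turnout of some of the voters,
  which allows the schedule to be changed for one voter at a time
  (\<open>expected_prod_mono_coarser\<close>).

  For a single voter everything else is constant, and the factors are functions of the voter's own
  independent turnout decisions, one for each part of the partition. The expectation is then the
  product over the parts \<open>M\<close> of the expectation of \<open>\<Prod>l\<in>M. g l b\<close>, where \<open>b\<close> is one coin toss.
  Merging parts means using the same coin for several factors in place of independent coins, and
  since all the factors are monotone in \<open>b\<close> in the same direction, they are positively correlated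
  under the common coin by Chebyshev's inequality (\<open>prod_expectation_le_expectation_prod\<close>).
\<close>

section \<open>Positive correlation under a common coin\<close>

lemma expectation_bool_pmf:
  fixes \<mu> :: "bool pmf" and g :: "bool \<Rightarrow> real"
  shows "measure_pmf.expectation \<mu> g = pmf \<mu> c * g c + pmf \<mu> (\<not> c) * g (\<not> c)"
proof -
  have "measure_pmf.expectation \<mu> g = (\<Sum>b\<in>UNIV. pmf \<mu> b *\<^sub>R g b)"
    by (rule integral_measure_pmf) auto
  then show ?thesis
    by (cases c) (simp_all add: UNIV_bool add.commute)
qed

lemma pmf_bool_sum: "pmf \<mu> c + pmf \<mu> (\<not> c) = (1::real)"
  using expectation_bool_pmf[of \<mu> "\<lambda>_. 1" c] by simp

text \<open>
  Chebyshev's inequality for two functions of one coin: with \<open>q\<close> and \<open>r\<close> the probabilities of the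
  two faces, the covariance is \<open>q * r * (F c - F (\<not> c)) * (G c - G (\<not> c))\<close>. Naming the
  face \<open>c\<close> on which both functions are larger treats the increasing and the decreasing case at once.
\<close>

lemma expectation_mult_le_expectation_of_mult:
  fixes \<mu> :: "bool pmf" and F G :: "bool \<Rightarrow> real"
  assumes "F (\<not> c) \<le> F c" and "G (\<not> c) \<le> G c"
  shows "measure_pmf.expectation \<mu> F * measure_pmf.expectation \<mu> G
    \<le> measure_pmf.expectation \<mu> (\<lambda>b. F b * G b)"
proof -
  define q r where "q = pmf \<mu> c" and "r = pmf \<mu> (\<not> c)"
  have r: "r = 1 - q" and nonneg: "0 \<le> q" "0 \<le> r"
    using pmf_bool_sum[of \<mu> c] by (auto simp: q_def r_def)
  have "measure_pmf.expectation \<mu> (\<lambda>b. F b * G b)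
      - measure_pmf.expectation \<mu> F * measure_pmf.expectation \<mu> G
      = q * r * ((F c - F (\<not> c)) * (G c - G (\<not> c)))"
    unfolding expectation_bool_pmf[of \<mu> _ c] q_def[symmetric] r_def[symmetric]
    by (simp add: r algebra_simps)
  also have "\<dots> \<ge> 0"
    using assms nonneg by (intro mult_nonneg_nonneg) auto
  finally show ?thesis by simp
qed

lemma prod_expectation_le_expectation_prod:
  fixes \<mu> :: "bool pmf" and g :: "'i \<Rightarrow> bool \<Rightarrow> real"
  assumes "finite I"
    and "\<And>i b. i \<in> I \<Longrightarrow> 0 \<le> g i b"
    and "\<And>i. i \<in> I \<Longrightarrow> g i (\<not> c) \<le> g i c"
  shows "(\<Prod>i\<in>I. measure_pmf.expectation \<mu> (g i))
    \<le> measure_pmf.expectation \<mu> (\<lambda>b. \<Prod>i\<in>I. g i b)"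
  using assms
proof (induction I rule: finite_induct)
  case empty
  show ?case by simp
next
  case (insert j I)
  have "(\<Prod>i\<in>insert j I. measure_pmf.expectation \<mu> (g i))
      \<le> measure_pmf.expectation \<mu> (g j) * measure_pmf.expectation \<mu> (\<lambda>b. \<Prod>i\<in>I. g i b)"
    using insert by (auto intro!: mult_left_mono integral_nonneg)
  also have "\<dots> \<le> measure_pmf.expectation \<mu> (\<lambda>b. g j b * (\<Prod>i\<in>I. g i b))"
    using insert.prems by (intro expectation_mult_le_expectation_of_mult[of _ c] prod_mono) auto
  finally show ?case using insert.hyps by simp
qed

text \<open>
  A part of the coarser partition is partitioned by the finer one, so the blocks of the finer
  partition can be grouped by the part that contains them, and each group is compared with its part.
\<close>

lemma prod_expectation_mono_refines:
  fixes \<mu> :: "bool pmf" and g :: "'l \<Rightarrow> bool \<Rightarrow> real"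
  assumes "finite L" and ref: "refines L P' P"
    and nonneg: "\<And>l b. l \<in> L \<Longrightarrow> 0 \<le> g l b"
    and mono: "\<And>l. l \<in> L \<Longrightarrow> g l (\<not> c) \<le> g l c"
  shows "(\<Prod>N\<in>P'. measure_pmf.expectation \<mu> (\<lambda>b. \<Prod>l\<in>N. g l b))
    \<le> (\<Prod>M\<in>P. measure_pmf.expectation \<mu> (\<lambda>b. \<Prod>l\<in>M. g l b))"
proof -
  let ?E = "\<lambda>N. measure_pmf.expectation \<mu> (\<lambda>b. \<Prod>l\<in>N. g l b)"
  let ?B = "\<lambda>M. {N \<in> P'. N \<subseteq> M}"
  have P: "partition_on L P" and P': "partition_on L P'"
    using ref by (auto simp: refines_def)
  have fin: "finite P" "finite P'"
    using assms(1) P P' by (auto intro: finite_elements)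
  have sub: "M \<subseteq> L" if "M \<in> P" for M
    using P that by (auto simp: partition_on_def)
  have P'_eq: "P' = (\<Union>M\<in>P. ?B M)"
    using ref by (auto simp: refines_def)
  have disj: "?B M1 \<inter> ?B M2 = {}" if "M1 \<in> P" "M2 \<in> P" "M1 \<noteq> M2" for M1 M2
  proof -
    have "M1 \<inter> M2 = {}"
      using P that by (auto simp: partition_on_def disjoint_def)
    moreover have "{} \<notin> P'"
      using P' by (rule partition_onD3)
    ultimately show ?thesis by auto (metis Int_greatest subset_empty)
  qed
  have block: "(\<Prod>N\<in>?B M. ?E N) \<le> ?E M" if M: "M \<in> P" for M
  proof -
    have part: "partition_on M (?B M)"
      using ref M by (rule refines_obtains_subset)
    have "(\<Prod>N\<in>?B M. ?E N) \<le> measure_pmf.expectation \<mu> (\<lambda>b. \<Prod>N\<in>?B M. \<Prod>l\<in>N. g l b)"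
      using fin sub[OF M] nonneg mono
      by (intro prod_expectation_le_expectation_prod[of _ _ c] prod_nonneg prod_mono) auto
    also have "(\<lambda>b. \<Prod>N\<in>?B M. \<Prod>l\<in>N. g l b) = (\<lambda>b. \<Prod>l\<in>M. g l b)"
    proof
      fix b
      have "(\<Prod>l\<in>\<Union>(?B M). g l b) = (\<Prod>N\<in>?B M. \<Prod>l\<in>N. g l b)"
        using part sub[OF M] finite_subset[OF _ assms(1)]
        by (subst prod.Union_disjoint) (auto simp: partition_on_def disjoint_def)
      then show "(\<Prod>N\<in>?B M. \<Prod>l\<in>N. g l b) = (\<Prod>l\<in>M. g l b)"
        using partition_onD1[OF part] by simp
    qed
    finally show ?thesis .
  qed
  have "(\<Prod>N\<in>P'. ?E N) = (\<Prod>M\<in>P. \<Prod>N\<in>?B M. ?E N)"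
    by (subst P'_eq, rule prod.UNION_disjoint) (use fin disj in auto)
  also have "\<dots> \<le> (\<Prod>M\<in>P. ?E M)"
  proof (intro prod_mono conjI block prod_nonneg)
    show "0 \<le> ?E N" if "M \<in> P" "N \<in> ?B M" for M N
      using that sub nonneg by (intro Bochner_Integration.integral_nonneg prod_nonneg) blast
  qed
  finally show ?thesis .
qed

section \<open>Changing the schedule one voter at a time\<close>

lemma refines_of_coarser:
  assumes "coarser H L \<pi> \<pi>'" "staggered_schedule H L \<pi>" "staggered_schedule H L \<pi>'" "h \<in> H"
  shows "refines L (\<pi>' h) (\<pi> h)"
proof -
  have P: "partition_on L (\<pi> h)" and P': "partition_on L (\<pi>' h)"
    using assms by (auto simp: staggered_schedule_def)
  have "\<exists>M\<in>\<pi> h. N \<subseteq> M" if N: "N \<in> \<pi>' h" for N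
  proof -
    obtain l where l: "l \<in> N"
      using partition_onD3[OF P'] N by fastforce
    have NL: "N \<subseteq> L"
      using partition_onD1[OF P'] N by blast
    obtain M where M: "M \<in> \<pi> h" "l \<in> M"
      using l NL partition_onD1[OF P] by blast
    have "l' \<in> M" if l': "l' \<in> N" for l'
    proof -
      have "simultaneous \<pi> h l l'"
        using assms(1,4) l l' N NL unfolding coarser_def simultaneous_def by blast
      then obtain M' where M': "M' \<in> \<pi> h" "l \<in> M'" "l' \<in> M'"
        by (auto simp: simultaneous_def)
      with M have "M = M'"
        using partition_onD2[OF P] unfolding disjoint_def by blast
      with M' show ?thesis by simp
    qed
    with M show ?thesis by blast
  qed
  with P P' show ?thesis by (simp add: refines_def)
qed

definition expected_prod ::
  "'h set \<Rightarrow> 'l set \<Rightarrow> ('h \<Rightarrow> real) \<Rightarrow> ('h \<Rightarrow> 'l set set) \<Rightarrow> ('l \<Rightarrow> 'h set \<Rightarrow> real) \<Rightarrow> real" where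
  "expected_prod H L p \<pi> f =
    measure_pmf.expectation (turnout_pmf H p \<pi>) (\<lambda>x. \<Prod>l\<in>L. f l (voted H \<pi> x l))"

text \<open>
  The direction in which a voter pushes may differ between voters, but neither between elections
  nor with the behaviour of the other voters.
\<close>

definition votes_aligned :: "'h set \<Rightarrow> 'l set \<Rightarrow> ('l \<Rightarrow> 'h set \<Rightarrow> real) \<Rightarrow> bool" where
  "votes_aligned H L f \<longleftrightarrow>
    (\<forall>h\<in>H. (\<forall>l\<in>L. \<forall>S. S \<subseteq> H \<longrightarrow> f l S \<le> f l (insert h S)) \<or>
            (\<forall>l\<in>L. \<forall>S. S \<subseteq> H \<longrightarrow> f l (insert h S) \<le> f l S))"

lemma votes_aligned_condition:
  assumes "votes_aligned (A \<union> B) L f" and "\<And>l. V l \<subseteq> A"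
  shows "votes_aligned B L (\<lambda>l S. f l (V l \<union> S))"
proof -
  have "V l \<union> S \<subseteq> A \<union> B" if "S \<subseteq> B" for l S
    using assms(2) that by blast
  then show ?thesis
    using assms(1) unfolding votes_aligned_def Un_insert_right by (meson UnCI)
qed

lemma voted_subset: "voted H \<pi> x l \<subseteq> H"
  by (auto simp: voted_def)

lemma turnout_pmf_cong:
  assumes "\<And>h. h \<in> H \<Longrightarrow> \<pi> h = \<rho> h"
  shows "turnout_pmf H p \<pi> = turnout_pmf H p \<rho>"
proof -
  have "(SIGMA h:H. \<pi> h) = (SIGMA h:H. \<rho> h)"
    using assms by auto
  then show ?thesis by (simp add: turnout_pmf_def)
qed

lemma voted_cong:
  assumes "\<And>h. h \<in> H \<Longrightarrow> \<pi> h = \<rho> h"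
  shows "voted H \<pi> x l = voted H \<rho> x l"
  using assms by (auto simp: voted_def)

lemma expected_prod_cong:
  assumes "\<And>h. h \<in> H \<Longrightarrow> \<pi> h = \<rho> h"
  shows "expected_prod H L p \<pi> f = expected_prod H L p \<rho> f"
  by (simp add: expected_prod_def turnout_pmf_cong[OF assms] voted_cong[OF assms])

lemma finite_dates:
  assumes "finite H" "finite L" "staggered_schedule H L \<pi>"
  shows "finite (SIGMA h:H. \<pi> h)"
  using assms by (auto simp: staggered_schedule_def intro: finite_elements)

lemma finite_set_turnout_pmf:
  assumes "finite (SIGMA h:H. \<pi> h)"
  shows "finite (set_pmf (turnout_pmf H p \<pi>))"
  unfolding turnout_pmf_def set_Pi_pmf[OF assms]
  by (rule finite_PiE_dflt) (use assms in auto)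

text \<open>
  The turnouts of disjoint groups of voters are independent, so the expectation can be taken first
  over one group and then over the other.
\<close>

lemma expected_prod_union:
  assumes "finite (SIGMA h:A. \<pi> h)" "finite (SIGMA h:B. \<pi> h)" "A \<inter> B = {}"
  shows "expected_prod (A \<union> B) L p \<pi> f =
    measure_pmf.expectation (turnout_pmf A p \<pi>)
      (\<lambda>x. expected_prod B L p \<pi> (\<lambda>l S. f l (voted A \<pi> x l \<union> S)))"
proof -
  let ?A = "SIGMA h:A. \<pi> h"
  let ?m = "\<lambda>(x, y) z. if z \<in> ?A then x z else (y z :: bool)"
  let ?h = "\<lambda>x. \<Prod>l\<in>L. f l (voted (A \<union> B) \<pi> x l)"
  have "(SIGMA h:A \<union> B. \<pi> h) = ?A \<union> (SIGMA h:B. \<pi> h)"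
    by auto
  then have "turnout_pmf (A \<union> B) p \<pi>
      = map_pmf ?m (pair_pmf (turnout_pmf A p \<pi>) (turnout_pmf B p \<pi>))"
    unfolding turnout_pmf_def using assms by (subst Pi_pmf_union[symmetric]) auto
  then have "expected_prod (A \<union> B) L p \<pi> f
      = measure_pmf.expectation (pair_pmf (turnout_pmf A p \<pi>) (turnout_pmf B p \<pi>)) (\<lambda>z. ?h (?m z))"
    by (simp add: expected_prod_def)
  also have "\<dots> = measure_pmf.expectation (turnout_pmf A p \<pi> \<bind>
      (\<lambda>x. map_pmf (Pair x) (turnout_pmf B p \<pi>))) (\<lambda>z. ?h (?m z))"
    by (simp add: pair_pmf_def map_pmf_def)
  also have "\<dots> = (\<Sum>x\<in>set_pmf (turnout_pmf A p \<pi>). pmf (turnout_pmf A p \<pi>) x *\<^sub>R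
      measure_pmf.expectation (turnout_pmf B p \<pi>) (\<lambda>y. ?h (?m (x, y))))"
    by (subst pmf_expectation_bind[where A = "set_pmf (turnout_pmf A p \<pi>)"])
       (use finite_set_turnout_pmf[OF assms(1)] finite_set_turnout_pmf[OF assms(2)] in auto)
  also have "\<dots> = measure_pmf.expectation (turnout_pmf A p \<pi>)
      (\<lambda>x. measure_pmf.expectation (turnout_pmf B p \<pi>) (\<lambda>y. ?h (?m (x, y))))"
    by (rule integral_measure_pmf[symmetric]) (use finite_set_turnout_pmf[OF assms(1)] in auto)
  also have "voted (A \<union> B) \<pi> (?m (x, y)) l = voted A \<pi> x l \<union> voted B \<pi> y l" for x y l
    using assms(3) by (auto simp: voted_def)
  then have "measure_pmf.expectation (turnout_pmf A p \<pi>)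
      (\<lambda>x. measure_pmf.expectation (turnout_pmf B p \<pi>) (\<lambda>y. ?h (?m (x, y))))
    = measure_pmf.expectation (turnout_pmf A p \<pi>)
      (\<lambda>x. expected_prod B L p \<pi> (\<lambda>l S. f l (voted A \<pi> x l \<union> S)))"
    by (simp only: expected_prod_def)
  finally show ?thesis .
qed

text \<open>
  A lone voter tosses one coin for each poll date, and the elections sharing a date share its coin.
\<close>

lemma expected_prod_single_voter:
  assumes "finite L" and part: "partition_on L (\<pi> h)"
    and nonneg: "\<And>l S. l \<in> L \<Longrightarrow> S \<subseteq> {h} \<Longrightarrow> 0 \<le> f l S"
  shows "expected_prod {h} L p \<pi> f =
    (\<Prod>M\<in>\<pi> h. measure_pmf.expectation (bernoulli_pmf (p h))
      (\<lambda>b. \<Prod>l\<in>M. f l (if b then {h} else {})))"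
proof -
  let ?D = "SIGMA k:{h}. \<pi> k"
  let ?g = "\<lambda>d b. \<Prod>l\<in>snd d. f l (if b then {h} else {})"
  have fin: "finite (\<pi> h)"
    using assms(1) part by (rule finite_elements)
  have D: "?D = Pair h ` \<pi> h" by auto
  have inj: "inj_on (Pair h) (\<pi> h)" by (auto intro: inj_onI)
  have sub: "M \<subseteq> L" if "M \<in> \<pi> h" for M
    using partition_onD1[OF part] that by blast
  have split: "(\<Prod>l\<in>L. f l (voted {h} \<pi> x l)) = (\<Prod>d\<in>?D. ?g d (x d))" for x
  proof -
    have "(\<Prod>l\<in>\<Union>(\<pi> h). f l (voted {h} \<pi> x l)) = (\<Prod>M\<in>\<pi> h. \<Prod>l\<in>M. f l (voted {h} \<pi> x l))"
      using sub finite_subset[OF _ assms(1)] partition_onD2[OF part]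
      by (subst prod.Union_disjoint) (auto simp: disjoint_def)
    also have "voted {h} \<pi> x l = (if x (h, M) then {h} else {})" if "M \<in> \<pi> h" "l \<in> M" for M l
    proof -
      have "M' = M" if "M' \<in> \<pi> h" "l \<in> M'" for M'
        using partition_onD2[OF part] that \<open>M \<in> \<pi> h\<close> \<open>l \<in> M\<close> by (auto simp: disjoint_def)
      then have "(\<exists>M'\<in>\<pi> h. l \<in> M' \<and> x (h, M')) \<longleftrightarrow> x (h, M)"
        using that by blast
      then show ?thesis by (auto simp: voted_def)
    qed
    then have "(\<Prod>M\<in>\<pi> h. \<Prod>l\<in>M. f l (voted {h} \<pi> x l)) = (\<Prod>M\<in>\<pi> h. ?g (h, M) (x (h, M)))"
      by (intro prod.cong) auto
    also have "\<dots> = (\<Prod>d\<in>?D. ?g d (x d))"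
      unfolding D by (simp add: prod.reindex[OF inj])
    finally show ?thesis
      using partition_onD1[OF part] by simp
  qed
  have "expected_prod {h} L p \<pi> f
      = measure_pmf.expectation (turnout_pmf {h} p \<pi>) (\<lambda>x. \<Prod>d\<in>?D. ?g d (x d))"
    by (simp only: expected_prod_def split)
  also have "\<dots> = (\<Prod>d\<in>?D. measure_pmf.expectation ((\<lambda>(k, M). bernoulli_pmf (p k)) d) (?g d))"
    unfolding turnout_pmf_def
  proof (rule expectation_prod_Pi_pmf)
    show "finite ?D" using fin by (simp only: D finite_imageI)
    show "integrable (measure_pmf ((\<lambda>(k, M). bernoulli_pmf (p k)) d)) (?g d)" for d
      by (rule integrable_measure_pmf_finite) simp
    show "0 \<le> ?g d b" if "d \<in> ?D" for d b
      using that sub[of "snd d"] by (intro prod_nonneg nonneg) auto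
  qed
  also have "\<dots> = (\<Prod>M\<in>\<pi> h. measure_pmf.expectation (bernoulli_pmf (p h))
      (\<lambda>b. \<Prod>l\<in>M. f l (if b then {h} else {})))"
    unfolding D by (simp add: prod.reindex[OF inj])
  finally show ?thesis .
qed

lemma expected_prod_mono_single_voter:
  assumes "finite L" and ref: "refines L (\<pi>' h) (\<pi> h)"
    and nonneg: "\<And>l S. l \<in> L \<Longrightarrow> S \<subseteq> {h} \<Longrightarrow> 0 \<le> f l S"
    and "votes_aligned {h} L f"
  shows "expected_prod {h} L p \<pi>' f \<le> expected_prod {h} L p \<pi> f"
proof -
  let ?g = "\<lambda>l b. f l (if b then {h} else {})"
  have "(\<forall>l\<in>L. f l {} \<le> f l {h}) \<or> (\<forall>l\<in>L. f l {h} \<le> f l {})"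
    using assms(4) unfolding votes_aligned_def by (metis empty_subsetI singletonI)
  then obtain c where c: "\<And>l. l \<in> L \<Longrightarrow> ?g l (\<not> c) \<le> ?g l c"
    by (metis (full_types))
  have "expected_prod {h} L p \<pi>' f
      = (\<Prod>M\<in>\<pi>' h. measure_pmf.expectation (bernoulli_pmf (p h)) (\<lambda>b. \<Prod>l\<in>M. ?g l b))"
    using assms(1) ref nonneg by (intro expected_prod_single_voter) (auto simp: refines_def)
  also have "\<dots> \<le> (\<Prod>M\<in>\<pi> h. measure_pmf.expectation (bernoulli_pmf (p h)) (\<lambda>b. \<Prod>l\<in>M. ?g l b))"
    using assms(1) ref nonneg c by (intro prod_expectation_mono_refines[of L _ _ ?g c]) auto
  also have "\<dots> = expected_prod {h} L p \<pi> f"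
    using assms(1) ref nonneg
    by (intro expected_prod_single_voter[symmetric]) (auto simp: refines_def)
  finally show ?thesis .
qed

lemma expected_prod_mono_coarser:
  assumes "finite H" "finite L"
    and "staggered_schedule H L \<pi>" "staggered_schedule H L \<pi>'" "coarser H L \<pi> \<pi>'"
    and "\<And>l S. l \<in> L \<Longrightarrow> S \<subseteq> H \<Longrightarrow> 0 \<le> f l S"
    and "votes_aligned H L f"
  shows "expected_prod H L p \<pi>' f \<le> expected_prod H L p \<pi> f"
  using assms(1,3-)
proof (induction H arbitrary: f rule: finite_induct)
  case empty
  have "expected_prod {} L p \<pi>' f = expected_prod {} L p \<pi> f"
    by (rule expected_prod_cong) simp
  then show ?case by simp
next
  case (insert h H)
  \<comment> \<open>The intermediate schedule is already coarse for the voters in \<open>H\<close> but still fine for \<open>h\<close>.\<close>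
  let ?\<rho> = "\<pi>(h := \<pi>' h)"
  have sched: "staggered_schedule H L \<pi>" "staggered_schedule H L \<pi>'"
      "staggered_schedule {h} L \<pi>" "staggered_schedule {h} L \<pi>'"
    and coarse: "coarser H L \<pi> \<pi>'"
    using insert.prems by (auto simp: staggered_schedule_def coarser_def)
  have H_eq: "\<pi> k = ?\<rho> k" if "k \<in> H" for k
    using that insert.hyps by auto
  have h_eq: "\<pi>' k = ?\<rho> k" if "k \<in> {h}" for k
    using that by auto
  have \<rho>: "staggered_schedule H L ?\<rho>" "staggered_schedule {h} L ?\<rho>"
    using sched H_eq by (auto simp: staggered_schedule_def)
  note dates = finite_dates[OF _ assms(2)]
  have disj: "{h} \<inter> H = {}" "H \<inter> {h} = {}"
    using insert.hyps by auto
  have al: "votes_aligned ({h} \<union> H) L f" "votes_aligned (H \<union> {h}) L f"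
    using insert.prems by simp_all
  have int: "integrable (measure_pmf (turnout_pmf A p \<sigma>)) (F :: _ \<Rightarrow> real)"
    if "finite A" "staggered_schedule A L \<sigma>" for A \<sigma> F
    using finite_set_turnout_pmf[OF dates[OF that]] by (rule integrable_measure_pmf_finite)
  have "expected_prod ({h} \<union> H) L p \<pi>' f
      = measure_pmf.expectation (turnout_pmf {h} p \<pi>')
          (\<lambda>x. expected_prod H L p \<pi>' (\<lambda>l S. f l (voted {h} \<pi>' x l \<union> S)))"
    using sched insert.hyps disj by (intro expected_prod_union dates) auto
  also have "\<dots> \<le> measure_pmf.expectation (turnout_pmf {h} p \<pi>')
          (\<lambda>x. expected_prod H L p \<pi> (\<lambda>l S. f l (voted {h} \<pi>' x l \<union> S)))"
  proof (intro integral_mono int insert.IH)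
    fix x
    show "votes_aligned H L (\<lambda>l S. f l (voted {h} \<pi>' x l \<union> S))"
      by (rule votes_aligned_condition[OF al(1) voted_subset])
    show "0 \<le> f l (voted {h} \<pi>' x l \<union> S)" if "l \<in> L" "S \<subseteq> H" for l S
      using that voted_subset[of "{h}" \<pi>' x l] by (intro insert.prems) auto
  qed (use sched coarse in auto)
  also have "\<dots> = measure_pmf.expectation (turnout_pmf {h} p ?\<rho>)
          (\<lambda>x. expected_prod H L p ?\<rho> (\<lambda>l S. f l (voted {h} ?\<rho> x l \<union> S)))"
    by (simp only: turnout_pmf_cong[OF h_eq] voted_cong[OF h_eq] expected_prod_cong[OF H_eq])
  also have "\<dots> = expected_prod (H \<union> {h}) L p ?\<rho> f"
    unfolding Un_commute[of H]
    by (intro expected_prod_union[symmetric] dates) (fact | simp add: insert.hyps)+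
  also have "\<dots> = measure_pmf.expectation (turnout_pmf H p ?\<rho>)
          (\<lambda>x. expected_prod {h} L p ?\<rho> (\<lambda>l S. f l (voted H ?\<rho> x l \<union> S)))"
    by (intro expected_prod_union dates) (fact | simp add: insert.hyps)+
  also have "\<dots> = measure_pmf.expectation (turnout_pmf H p \<pi>)
          (\<lambda>x. expected_prod {h} L p \<pi>' (\<lambda>l S. f l (voted H \<pi> x l \<union> S)))"
    by (simp only: turnout_pmf_cong[OF H_eq] voted_cong[OF H_eq] expected_prod_cong[OF h_eq])
  also have "\<dots> \<le> measure_pmf.expectation (turnout_pmf H p \<pi>)
          (\<lambda>x. expected_prod {h} L p \<pi> (\<lambda>l S. f l (voted H \<pi> x l \<union> S)))"
  proof (intro integral_mono int expected_prod_mono_single_voter assms(2))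
    fix x
    show "votes_aligned {h} L (\<lambda>l S. f l (voted H \<pi> x l \<union> S))"
      by (rule votes_aligned_condition[OF al(2) voted_subset])
    show "0 \<le> f l (voted H \<pi> x l \<union> S)" if "l \<in> L" "S \<subseteq> {h}" for l S
      using that voted_subset[of H \<pi> x l] by (intro insert.prems) auto
    show "refines L (\<pi>' h) (\<pi> h)"
      using insert.prems by (intro refines_of_coarser) auto
  qed (use sched insert.hyps in auto)
  also have "\<dots> = expected_prod (H \<union> {h}) L p \<pi> f"
    using sched insert.hyps disj by (intro expected_prod_union[symmetric] dates) auto
  finally show ?case by simp
qed

section \<open>The probability of a sweep\<close>

text \<open>
  Fixing the electorates of all elections, the sweeps of the different parties are disjoint events
  because some election exists and has at most one winner, and each of them is an intersection
  of independent events.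
\<close>

lemma prob_sweep_given_turnout:
  assumes "finite L" "L \<noteq> {}" "finite T"
    and parties: "\<And>l X. l \<in> L \<Longrightarrow> X \<in> set_pmf (W l (V l)) \<Longrightarrow> X \<subseteq> T"
    and one: "\<And>l X. l \<in> L \<Longrightarrow> X \<in> set_pmf (W l (V l)) \<Longrightarrow> card X \<le> 1"
  shows "measure_pmf.prob (Pi_pmf L {} (\<lambda>l. W l (V l))) (sweep L T)
    = (\<Sum>s\<in>T. \<Prod>l\<in>L. win_prob W l s (V l))"
proof -
  let ?M = "Pi_pmf L {} (\<lambda>l. W l (V l))"
  let ?A = "\<lambda>s. Pi L (\<lambda>_. {X. s \<in> X}) \<inter> set_pmf ?M"
  have "disjoint_family_on ?A T"
  proof (unfold disjoint_family_on_def, intro ballI impI equals0I)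
    fix s s' w
    assume s: "s \<in> T" "s' \<in> T" "s \<noteq> s'" and w: "w \<in> ?A s \<inter> ?A s'"
    obtain l where l: "l \<in> L" using assms(2) by blast
    then have "w l \<in> set_pmf (W l (V l))"
      using w by (auto simp: set_Pi_pmf[OF assms(1)] PiE_dflt_def)
    then have "finite (w l)" "card (w l) \<le> 1"
      using parties one l finite_subset[OF _ assms(3)] by blast+
    moreover have "s \<in> w l" "s' \<in> w l"
      using w l by auto
    ultimately show False
      using s(3) card_le_Suc0_iff_eq[of "w l"] by auto
  qed
  then have "measure_pmf.prob ?M (\<Union>s\<in>T. ?A s) = (\<Sum>s\<in>T. measure_pmf.prob ?M (?A s))"
    using assms(3) by (intro measure_pmf.finite_measure_finite_Union) auto
  moreover have "(\<Union>s\<in>T. ?A s) = sweep L T \<inter> set_pmf ?M"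
    by (auto simp: sweep_def)
  ultimately have "measure_pmf.prob ?M (sweep L T \<inter> set_pmf ?M)
      = (\<Sum>s\<in>T. measure_pmf.prob ?M (?A s))"
    by (simp only:)
  then show ?thesis
    by (simp only: measure_Int_set_pmf measure_Pi_pmf_Pi[OF assms(1)] win_prob_def)
qed

lemma prob_sweep_eq_sum_expected_prod:
  assumes "finite H" "finite L" "L \<noteq> {}" "finite T" "staggered_schedule H L \<pi>"
    and parties: "\<And>l S X. l \<in> L \<Longrightarrow> S \<subseteq> H \<Longrightarrow> X \<in> set_pmf (W l S) \<Longrightarrow> X \<subseteq> T"
    and one: "\<And>l S X. l \<in> L \<Longrightarrow> S \<subseteq> H \<Longrightarrow> X \<in> set_pmf (W l S) \<Longrightarrow> card X \<le> 1"
  shows "measure_pmf.prob (outcome_pmf H L p W \<pi>) (sweep L T)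
    = (\<Sum>s\<in>T. expected_prod H L p \<pi> (\<lambda>l. win_prob W l s))"
proof -
  let ?Q = "turnout_pmf H p \<pi>"
  have fin: "finite (set_pmf ?Q)"
    using assms by (intro finite_set_turnout_pmf finite_dates)
  have given: "measure_pmf.prob (Pi_pmf L {} (\<lambda>l. W l (voted H \<pi> x l))) (sweep L T)
      = (\<Sum>s\<in>T. \<Prod>l\<in>L. win_prob W l s (voted H \<pi> x l))" for x
    by (rule prob_sweep_given_turnout[OF assms(2-4)])
       (erule parties[OF _ voted_subset] one[OF _ voted_subset], assumption)+
  have "measure_pmf.prob (outcome_pmf H L p W \<pi>) (sweep L T)
      = measure_pmf.expectation ?Q
          (\<lambda>x. measure_pmf.prob (Pi_pmf L {} (\<lambda>l. W l (voted H \<pi> x l))) (sweep L T))"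
    unfolding outcome_pmf_def measure_pmf_bind
    by (rule measure_pmf.measure_bind[where N = "count_space UNIV"]) (simp_all add: measure_pmf_in_subprob_algebra)
  also have "\<dots> = measure_pmf.expectation ?Q
          (\<lambda>x. \<Sum>s\<in>T. \<Prod>l\<in>L. win_prob W l s (voted H \<pi> x l))"
    by (simp only: given)
  also have "\<dots> = (\<Sum>s\<in>T. expected_prod H L p \<pi> (\<lambda>l. win_prob W l s))"
    unfolding expected_prod_def
    by (rule Bochner_Integration.integral_sum) (rule integrable_measure_pmf_finite[OF fin])
  finally show ?thesis .
qed

theorem theoremC:
  fixes H :: "'h set" and L :: "'l set" and T :: "'t set"
    and t :: "'h \<Rightarrow> 't" and p :: "'h \<Rightarrow> real"
    and W :: "'l \<Rightarrow> 'h set \<Rightarrow> 't set pmf"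
    and \<pi> \<pi>' :: "'h \<Rightarrow> 'l set set"
  assumes "finite H" and "finite L" and "finite T"
    and "\<And>h. h \<in> H \<Longrightarrow> t h \<in> T"
    and "\<And>h. h \<in> H \<Longrightarrow> 0 \<le> p h \<and> p h \<le> 1"
    and winners_are_parties:
      "\<And>l S X. l \<in> L \<Longrightarrow> S \<subseteq> H \<Longrightarrow> X \<in> set_pmf (W l S) \<Longrightarrow> X \<subseteq> T"
    and at_most_one_winner:
      "\<And>l S X. l \<in> L \<Longrightarrow> S \<subseteq> H \<Longrightarrow> X \<in> set_pmf (W l S) \<Longrightarrow> card X \<le> 1"
    and extra_vote_own:
      "\<And>l S h. l \<in> L \<Longrightarrow> S \<subseteq> H \<Longrightarrow> h \<in> H \<Longrightarrow>
        win_prob W l (t h) S \<le> win_prob W l (t h) (S \<union> {h})"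
    and extra_vote_rival:
      "\<And>l S h s. l \<in> L \<Longrightarrow> S \<subseteq> H \<Longrightarrow> h \<in> H \<Longrightarrow> s \<in> T \<Longrightarrow> s \<noteq> t h \<Longrightarrow>
        win_prob W l s (S \<union> {h}) \<le> win_prob W l s S"
    and "staggered_schedule H L \<pi>" and "staggered_schedule H L \<pi>'"
    and "coarser H L \<pi> \<pi>'"
  shows "measure_pmf.prob (outcome_pmf H L p W \<pi>) (sweep L T)
    \<ge> measure_pmf.prob (outcome_pmf H L p W \<pi>') (sweep L T)"
proof (cases "L = {}")
  case True
  \<comment> \<open>Without elections every party wins vacuously, so a sweep is certain or impossible.\<close>
  then have "sweep L T = UNIV \<or> sweep L T = {}"
    by (auto simp: sweep_def)
  then show ?thesis by auto
next
  case False
  have "expected_prod H L p \<pi>' (\<lambda>l. win_prob W l s) \<le> expected_prod H L p \<pi> (\<lambda>l. win_prob W l s)"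
    if s: "s \<in> T" for s
  proof (rule expected_prod_mono_coarser)
    show "votes_aligned H L (\<lambda>l. win_prob W l s)"
      unfolding votes_aligned_def
    proof
      fix h assume h: "h \<in> H"
      show "(\<forall>l\<in>L. \<forall>S. S \<subseteq> H \<longrightarrow> win_prob W l s S \<le> win_prob W l s (insert h S)) \<or>
            (\<forall>l\<in>L. \<forall>S. S \<subseteq> H \<longrightarrow> win_prob W l s (insert h S) \<le> win_prob W l s S)"
      proof (cases "s = t h")
        case True
        then show ?thesis using extra_vote_own[OF _ _ h] by simp
      next
        case False
        then show ?thesis using extra_vote_rival[OF _ _ h s] by simp
      qed
    qed
    show "0 \<le> win_prob W l s S" for l S
      by (simp add: win_prob_def)
  qed fact+
  then show ?thesis
    using assms(1-3,10,11) False winners_are_parties at_most_one_winner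
    by (simp add: prob_sweep_eq_sum_expected_prod sum_mono)
qed

end
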